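(* Let $x^*\in\mathbb{R}^p$ satisfy $F(x^* )=0$ and suppose there exists $\mu>0$ such that $$f_y(x^* )\;\ge\; f_y(x)+\langle\nabla f_y(x),x^*-x\rangle+\frac{\mu}{2}\|x^*-x\|^2\qquad\text{for all }x,y\in\mathbb{R}^p.$$ If $0<\gamma\le1$, then $\mu\le1$ and the iterates of the Sketched Newton-Raphson (SNR) method converge linearly: for all $k\ge0$ $$\mathbb{E}\big[\|x^{k+1}-x^*\|^2\big]\le(1-\gamma\mu)^{k+1}\|x^0-x^*\|^2 .$$
   Context: $F:\mathbb{R}^p\to\mathbb{R}^m$ is continuously differentiable, and $DF(x)=[\nabla F_1(x)\ \cdots\ \nabla F_m(x)]\in\mathbb{R}^{p\times m}$ is the transpose of its Jacobian. For each $x\in\mathbb{R}^p$, $\mathcal{D}_x$ is a probability distribution over sketching matrices $\mathbf{S}\in\mathbb{R}^{m\times\tau}$. $\dagger$ denotes the Moore-Penrose pseudoinverse and $\mathbf{H}_{\mathbf{S}}(x)=\mathbf{S}\big(\mathbf{S}^\top DF(x)^\top DF(x)\mathbf{S}\big)^\dagger\mathbf{S}^\top\in\mathbb{R}^{m\times m}$. Define $f_y(x)=\tfrac12F(x)^\top\,\mathbb{E}_{\mathbf{S}\sim\mathcal{D}_y}[\mathbf{H}_{\mathbf{S}}(y)]\,F(x)$ (the expectation is understood to be finite), with gradient in $x$ for fixed $y$: $\nabla f_y(x)=DF(x)\,\mathbb{E}_{\mathbf{S}\sim\mathcal{D}_y}[\mathbf{H}_{\mathbf{S}}(y)]\,F(x)$.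 $\|\cdot\|$ is the Euclidean norm. SNR method: given a deterministic $x^0\in\mathbb{R}^p$ and stepsize $\gamma>0$, at each $k\ge0$ sample a fresh $\mathbf{S}_k\sim\mathcal{D}_{x^k}$ (conditionally on $x^k$) and set $$x^{k+1}=x^k-\gamma\,DF(x^k)\mathbf{S}_k\big(\mathbf{S}_k^\top DF(x^k)^\top DF(x^k)\mathbf{S}_k\big)^\dagger\mathbf{S}_k^\top F(x^k).$$ *)

theory Defs
  imports "HOL-Probability.Probability"
begin

text \<open>Moore--Penrose pseudoinverse of a real matrix. The four Penrose equations always have
  exactly one solution, so the description is well defined.\<close>

definition pinv :: "real^'n^'m \<Rightarrow> real^'m^'n" where
  "pinv A = (THE P. A ** P ** A = A \<and> P ** A ** P = P \<and>
                    transpose (A ** P) = A ** P \<and> transpose (P ** A) = P ** A)"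

definition continuously_differentiable :: "(real^'p \<Rightarrow> real^'m) \<Rightarrow> bool" where
  "continuously_differentiable F \<longleftrightarrow>
     (\<forall>x. F differentiable (at x)) \<and> continuous_on UNIV (\<lambda>x. jacobian F (at x))"

text \<open>The type \<open>real^'m^'p\<close> is that of matrices with rows indexed by \<open>'p\<close> and columns indexed
  by \<open>'m\<close>, i.e. \<open>p \<times> m\<close> matrices. The columns of \<open>DF F x\<close> are the gradients of the components of
  \<open>F\<close>, so it is the transpose of the Jacobian.\<close>

definition DF :: "(real^'p \<Rightarrow> real^'m) \<Rightarrow> real^'p \<Rightarrow> real^'m^'p" where
  "DF F x = transpose (jacobian F (at x))"

definition H :: "(real^'p \<Rightarrow> real^'m) \<Rightarrow> real^'p \<Rightarrow> real^'t^'m \<Rightarrow> real^'m^'m" where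
  "H F x S = S ** pinv (transpose S ** transpose (DF F x) ** DF F x ** S) ** transpose S"

definition expected_H ::
  "(real^'p \<Rightarrow> real^'m) \<Rightarrow> (real^'p \<Rightarrow> (real^'t^'m) measure) \<Rightarrow> real^'p \<Rightarrow> real^'m^'m" where
  "expected_H F D y = (\<integral>S. H F y S \<partial>(D y))"

definition f_sub ::
  "(real^'p \<Rightarrow> real^'m) \<Rightarrow> (real^'p \<Rightarrow> (real^'t^'m) measure) \<Rightarrow> real^'p \<Rightarrow> real^'p \<Rightarrow> real" where
  "f_sub F D y x = 1/2 * (F x \<bullet> (expected_H F D y *v F x))"

definition grad :: "('a::real_inner \<Rightarrow> real) \<Rightarrow> 'a \<Rightarrow> 'a" where
  "grad f x = (THE g. GDERIV f x :> g)"

text \<open>The iterates generated by a given sequence of sketching matrices.\<close>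

primrec snr_iter ::
  "(real^'p \<Rightarrow> real^'m) \<Rightarrow> real \<Rightarrow> real^'p \<Rightarrow> (nat \<Rightarrow> real^'t^'m) \<Rightarrow> nat \<Rightarrow> real^'p" where
  "snr_iter F \<gamma> x0 S 0 = x0"
| "snr_iter F \<gamma> x0 S (Suc k) =
     (let x = snr_iter F \<gamma> x0 S k in
      x - \<gamma> *\<^sub>R ((DF F x ** S k ** pinv (transpose (S k) ** transpose (DF F x) ** DF F x ** S k)
                  ** transpose (S k)) *v F x))"

text \<open>The sigma-algebra generated by \<open>S 0, \<dots>, S (k - 1)\<close>. Since the starting point is
  deterministic, it describes the whole past of the method when the \<open>k\<close>-th sketch is drawn.\<close>

definition sketch_history ::
  "'w measure \<Rightarrow> (nat \<Rightarrow> 'w \<Rightarrow> real^'t^'m) \<Rightarrow> nat \<Rightarrow> 'w measure" where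
  "sketch_history M S k =
     vimage_algebra (space M) (\<lambda>\<omega>. \<lambda>i\<in>{..<k}. S i \<omega>) (Pi\<^sub>M {..<k} (\<lambda>_. borel))"

text \<open>The random matrices \<open>S k\<close> on the probability space \<open>M\<close> are the sketches of a run of the
  method: given the past, the conditional law of \<open>S k\<close> is the distribution attached by \<open>D\<close> to the
  current iterate. In particular \<open>S k\<close> depends on the past through the current iterate only.\<close>

definition snr_sketches ::
  "(real^'p \<Rightarrow> real^'m) \<Rightarrow> (real^'p \<Rightarrow> (real^'t^'m) measure) \<Rightarrow> real \<Rightarrow> real^'p \<Rightarrow>
   'w measure \<Rightarrow> (nat \<Rightarrow> 'w \<Rightarrow> real^'t^'m) \<Rightarrow> bool" where
  "snr_sketches F D \<gamma> x0 M S \<longleftrightarrow>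
     prob_space M \<and>
     (\<forall>k. S k \<in> borel_measurable M) \<and>
     (\<forall>k. \<forall>A\<in>sets borel. AE \<omega> in M.
        real_cond_exp M (sketch_history M S k) (indicator (S k -` A \<inter> space M)) \<omega> =
        measure (D (snr_iter F \<gamma> x0 (\<lambda>i. S i \<omega>) k)) A)"

end

theory Submission
  imports Defs
begin

text \<open>Let \<open>G = DF F x\<close>, \<open>v = F x\<close> and let \<open>H\<close> be the matrix of a random sketch. Since \<open>H\<close> is symmetric
  and \<open>H G\<^sup>T G H = H\<close>, the squared length of the direction \<open>G H v\<close> is \<open>v\<^sup>T H v\<close>. Both this and the cross
  term of \<open>\<parallel>x - \<gamma> G H v - x\<^sup>*\<parallel>\<^sup>2\<close> are linear in \<open>H\<close>, so the conditional expectation of the squared distance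
  is obtained by replacing \<open>H\<close> by its mean. For \<open>\<gamma> \<le> 1\<close> it is at most
  \<open>\<parallel>x - x\<^sup>*\<parallel>\<^sup>2 + 2\<gamma> (f x + \<nabla>f x \<bullet> (x\<^sup>* - x))\<close> with \<open>f = f_sub F D x\<close>, and the convexity hypothesis bounds it by
  \<open>(1 - \<gamma>\<mu>) \<parallel>x - x\<^sup>*\<parallel>\<^sup>2\<close>. Taking \<open>\<gamma> = 1\<close> and \<open>x \<noteq> x\<^sup>*\<close> gives \<open>\<mu> \<le> 1\<close>, because the expectation is nonnegative.\<close>

section \<open>Matrices and the Moore--Penrose inverse\<close>

text \<open>A closed set of values is a countable union of compact pieces cut out by balls. Over a
  compact piece the preimage is the projection of part of the closed graph along a compact factor,
  hence closed. Pairs list the value first because that coordinate is projected away.\<close>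

lemma borel_measurable_closed_graph:
  fixes f :: "'a::euclidean_space \<Rightarrow> 'b::euclidean_space"
  assumes "closed {(f x, x) |x. True}"
  shows "f \<in> borel_measurable borel"
proof (rule measurable_sigma_sets[where \<Omega>=UNIV and A="Collect closed"])
  show "sets borel = sigma_sets UNIV (Collect closed)"
    by (simp add: borel_eq_closed)
  fix C :: "'b set" assume "C \<in> Collect closed"
  then have C: "closed C" by simp
  define V where "V n = f -` (C \<inter> cball 0 (real n))" for n
  have "V n \<in> sets borel" for n
  proof -
    have "closed {x. \<exists>y. y \<in> C \<inter> cball 0 (real n) \<and> (y, x) \<in> {(f x, x) |x. True}}"
      by (rule closed_compact_projection[OF closed_Int_compact[OF C compact_cball] assms])
    also have "{x. \<exists>y. y \<in> C \<inter> cball 0 (real n) \<and> (y, x) \<in> {(f x, x) |x. True}} = V n"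
      unfolding V_def by blast
    finally show ?thesis by (rule borel_closed)
  qed
  then have "(\<Union>n. V n) \<in> sets borel"
    by blast
  moreover have "f -` C = (\<Union>n. V n)"
  proof (intro equalityI subsetI)
    fix x assume "x \<in> f -` C"
    moreover obtain n where "norm (f x) \<le> real n"
      using real_arch_simple by blast
    ultimately show "x \<in> (\<Union>n. V n)"
      by (auto simp: V_def)
  qed (auto simp: V_def)
  ultimately show "f -` C \<inter> space borel \<in> sets borel"
    by simp
qed auto

section \<open>Continuity and measurability of matrix operations\<close>

lemma continuous_on_transpose [continuous_intros]:
  "continuous_on S f \<Longrightarrow> continuous_on S (\<lambda>x. transpose (f x :: real^'n^'m))"
  unfolding transpose_def by (intro continuous_intros)

lemma continuous_on_matrix_matrix_mult [continuous_intros]: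
  "continuous_on S f \<Longrightarrow> continuous_on S g \<Longrightarrow>
    continuous_on S (\<lambda>x. (f x :: real^'n^'m) ** (g x :: real^'k^'n))"
  unfolding matrix_matrix_mult_def by (intro continuous_intros)

lemma continuous_on_matrix_vector_mult [continuous_intros]:
  "continuous_on S f \<Longrightarrow> continuous_on S g \<Longrightarrow>
    continuous_on S (\<lambda>x. (f x :: real^'n^'m) *v g x)"
  unfolding matrix_vector_mult_def by (intro continuous_intros)

lemma borel_measurable_transpose [measurable (raw)]:
  "f \<in> borel_measurable M \<Longrightarrow> (\<lambda>x. transpose (f x :: real^'n^'m)) \<in> borel_measurable M"
  by (rule borel_measurable_continuous_on[of transpose]) (intro continuous_intros)

lemma borel_measurable_matrix_matrix_mult [measurable (raw)]:
  "f \<in> borel_measurable M \<Longrightarrow> g \<in> borel_measurable M \<Longrightarrow>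
    (\<lambda>x. (f x :: real^'n^'m) ** (g x :: real^'k^'n)) \<in> borel_measurable M"
  by (rule borel_measurable_continuous_Pair) (assumption | intro continuous_intros)+

lemma borel_measurable_matrix_vector_mult [measurable (raw)]:
  "f \<in> borel_measurable M \<Longrightarrow> g \<in> borel_measurable M \<Longrightarrow>
    (\<lambda>x. (f x :: real^'n^'m) *v g x) \<in> borel_measurable M"
  by (rule borel_measurable_continuous_Pair) (assumption | intro continuous_intros)+

section \<open>Penrose equations: uniqueness, existence and measurability of the solution\<close>

definition penrose :: "real^'n^'m \<Rightarrow> real^'m^'n \<Rightarrow> bool" where
  "penrose A P \<longleftrightarrow> A ** P ** A = A \<and> P ** A ** P = P \<and>
     transpose (A ** P) = A ** P \<and> transpose (P ** A) = P ** A"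

text \<open>\<open>A ** P\<close> and \<open>A ** Q\<close> are both the orthogonal projector onto
  the range of \<open>A\<close>; \<open>P ** A\<close> and \<open>Q ** A\<close> are both the one
  onto its row space. Once these agree, \<open>P = Q ** A ** P = Q ** A ** Q = Q\<close>.\<close>

lemma penrose_unique:
  assumes P: "penrose A P" and Q: "penrose A Q"
  shows "P = Q"
proof -
  have P': "A ** P ** A = A" "P ** A ** P = P" "transpose (A ** P) = A ** P" "transpose (P ** A) = P ** A"
   and Q': "A ** Q ** A = A" "Q ** A ** Q = Q" "transpose (A ** Q) = A ** Q" "transpose (Q ** A) = Q ** A"
    using P Q by (auto simp: penrose_def)
  have "A ** P = transpose (A ** Q ** A ** P)"
    using P' Q' by (simp add: matrix_mul_assoc)
  also have "\<dots> = transpose (A ** P) ** transpose (A ** Q)"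
    by (simp add: matrix_transpose_mul matrix_mul_assoc)
  also have "\<dots> = A ** P ** A ** Q"
    using P' Q' by (simp add: matrix_mul_assoc)
  finally have AP: "A ** P = A ** Q"
    using P' by simp
  have "P ** A = transpose (P ** (A ** Q ** A))"
    using P' Q' by simp
  also have "\<dots> = transpose (Q ** A) ** transpose (P ** A)"
    by (simp add: matrix_transpose_mul matrix_mul_assoc)
  also have "\<dots> = Q ** (A ** P ** A)"
    by (simp only: P'(4) Q'(4) matrix_mul_assoc)
  finally have PA: "P ** A = Q ** A"
    using P' by simp
  have "P = Q ** A ** P"
    using P'(2) PA by simp
  also have "\<dots> = Q ** (A ** P)"
    by (simp add: matrix_mul_assoc)
  also have "\<dots> = Q"
    unfolding AP using Q'(2) by (simp add: matrix_mul_assoc)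
  finally show ?thesis .
qed

text \<open>Column by column this is a least-squares problem: the right-hand side is projected onto
  the range of \<open>A\<close>, and the residual, orthogonal to that range, is killed by the
  transpose.\<close>

lemma normal_equations_solvable:
  fixes A :: "real^'n^'m"
  shows "\<exists>X :: real^'m^'n. transpose A ** A ** X = transpose A"
proof -
  have "\<exists>x. transpose A *v (A *v x) = transpose A *v b" for b
  proof -
    obtain y z where y: "y \<in> span (range ((*v) A))"
      and z: "\<And>w. w \<in> span (range ((*v) A)) \<Longrightarrow> orthogonal z w" and b: "b = y + z"
      using orthogonal_subspace_decomp_exists[of "range ((*v) A)" b] by blast
    have sub: "subspace (range ((*v) A))"
      by (intro linear_subspace_image) auto
    then obtain x where x: "y = A *v x"
      using y span_eq_iff[THEN iffD2, OF sub] by blast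
    have "w \<bullet> (transpose A *v z) = 0" for w
    proof -
      have "w \<bullet> (transpose A *v z) = (A *v w) \<bullet> z"
        by (metis dot_lmul_matrix inner_commute transpose_matrix_vector)
      also have "\<dots> = 0"
        using z[of "A *v w"] by (simp add: span_base orthogonal_def inner_commute)
      finally show ?thesis .
    qed
    then have "transpose A *v z = 0"
      using inner_eq_zero_iff by blast
    then show ?thesis
      unfolding b x by (metis add.right_neutral matrix_vector_right_distrib)
  qed
  then obtain h where h: "\<And>b. transpose A *v (A *v h b) = transpose A *v b"
    by metis
  \<comment> \<open>\<open>h\<close> is chosen pointwise and need not be linear, so only its values
    on the standard basis are kept, as columns of \<open>X\<close>. Linearity then extends the
    identity to every vector.\<close>
  define X where "X = transpose (\<chi> j. h (axis j 1))"
  have X: "X *v axis j 1 = h (axis j 1)" for j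
    by (simp add: X_def matrix_vector_mult_basis) (simp add: row_def)
  have "transpose A ** A ** X = transpose A"
  proof (rule matrix_eq[THEN iffD2], rule)
    fix v
    have lin: "linear (\<lambda>v. (transpose A ** A ** X) *v v)" "linear (\<lambda>v. transpose A *v v)"
      by (rule matrix_vector_mul_linear)+
    show "(transpose A ** A ** X) *v v = transpose A *v v"
    proof (rule linear_eq_stdbasis[OF lin, THEN fun_cong])
      fix b :: "real^'m" assume "b \<in> Basis"
      then obtain j where "b = axis j 1" by (auto simp: Basis_vec_def)
      then show "(transpose A ** A ** X) *v b = transpose A *v b"
        using X h by (simp add: matrix_vector_mul_assoc[symmetric] del: transpose_matrix_vector)
    qed
  qed
  then show ?thesis by blast
qed

text \<open>If \<open>X\<close> is a least-squares inverse (\<open>A X\<close> symmetric) and \<open>Z\<close> a minimum-norm inverse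
  (\<open>Z A\<close> symmetric), then \<open>Z A X\<close> satisfies all four Penrose equations.\<close>

lemma penrose_exists: "\<exists>P. penrose (A :: real^'n^'m) P"
proof -
  \<comment> \<open>Transposing the hypothesis gives
    \<open>transpose X ** (transpose B ** B) = B\<close>. Substituting this for \<open>B\<close> in
    \<open>B ** X\<close> leaves \<open>transpose X ** transpose B\<close>, so \<open>B ** X\<close>
    is symmetric.\<close>
  have inv: "B ** X ** B = B \<and> transpose (B ** X) = B ** X"
    if X: "transpose B ** B ** X = transpose B" for B :: "real^'i^'j" and X
  proof -
    have B: "transpose X ** (transpose B ** B) = B"
      using arg_cong[OF X, of transpose] by (simp add: matrix_transpose_mul)
    have "B ** X = transpose X ** (transpose B ** B ** X)"
      by (subst B[symmetric]) (simp add: matrix_mul_assoc)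
    then have BX: "B ** X = transpose (B ** X)"
      by (simp add: X matrix_transpose_mul)
    then show ?thesis
      using B by (metis matrix_mul_assoc matrix_transpose_mul)
  qed
  obtain X where X: "transpose A ** A ** X = transpose A"
    using normal_equations_solvable by blast
  \<comment> \<open>These are the normal equations of the transposed matrix; transposing their
    solution gives the minimum-norm inverse.\<close>
  obtain Y where Y: "transpose (transpose A) ** transpose A ** Y = transpose (transpose A)"
    using normal_equations_solvable by blast
  define Z where "Z = transpose Y"
  note AX = inv[OF X]
  have ZA: "A ** Z ** A = A" "transpose (Z ** A) = Z ** A"
    using inv[OF Y] unfolding Z_def
    by (metis matrix_mul_assoc matrix_transpose_mul transpose_transpose)+
  have 1: "A ** (Z ** A ** X) = A ** X"
    using ZA by (simp add: matrix_mul_assoc)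
  have 2: "Z ** A ** X ** A = Z ** A"
    using AX by (metis matrix_mul_assoc)
  have "Z ** A ** X ** A ** (Z ** A ** X) = Z ** A ** X"
    unfolding 2 using ZA by (metis matrix_mul_assoc)
  then have "penrose A (Z ** A ** X)"
    unfolding penrose_def 1 2 using AX ZA by simp
  then show ?thesis ..
qed

lemma penrose_pinv: "penrose A (pinv A)"
  unfolding pinv_def penrose_def[symmetric]
  by (rule theI') (use penrose_exists penrose_unique in blast)

lemma penrose_iff_pinv: "penrose A P \<longleftrightarrow> P = pinv A"
  using penrose_pinv penrose_unique by blast

text \<open>Transposing swaps the two symmetry equations and preserves the other two, so uniqueness
  applies.\<close>

lemma pinv_transpose: "pinv (transpose A) = transpose (pinv A)"
proof -
  have *: "penrose (transpose A) (transpose P)" if "penrose A P" for P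
    using that unfolding penrose_def
    by (metis matrix_mul_assoc matrix_transpose_mul transpose_transpose)
  show ?thesis
    using *[OF penrose_pinv] penrose_iff_pinv by metis
qed

lemma borel_measurable_pinv [measurable]:
  "(pinv :: real^'n^'m \<Rightarrow> _) \<in> borel_measurable borel"
proof (rule borel_measurable_closed_graph)
  have "closed {p :: (real^'m^'n) \<times> (real^'n^'m). penrose (snd p) (fst p)}"
    unfolding penrose_def
    by (intro closed_Collect_conj closed_Collect_eq continuous_intros)
  also have "{p :: (real^'m^'n) \<times> (real^'n^'m). penrose (snd p) (fst p)} = {(pinv x, x) |x. True}"
    by (auto simp: penrose_iff_pinv)
  finally show "closed {(pinv x :: real^'m^'n, x :: real^'n^'m) |x. True}" .
qed

section \<open>Integration against a conditional law\<close>

text \<open>The kernel \<open>\<kappa>\<close> is not assumed measurable, so the inner integral is only almost everywhere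
  equal to a measurable function \<open>q\<close>.\<close>

lemma disintegration_cond_law:
  fixes M :: "'w measure" and X :: "'w \<Rightarrow> 'a" and Y :: "'w \<Rightarrow> 'b"
  assumes "prob_space M" and sub: "subalgebra M G"
    and X: "X \<in> measurable G N" and Y: "Y \<in> measurable M L"
    and \<kappa>: "\<And>\<omega>. prob_space (\<kappa> \<omega>)" "\<And>\<omega>. sets (\<kappa> \<omega>) = sets L"
    and law: "\<And>B. B \<in> sets L \<Longrightarrow>
      AE \<omega> in M. real_cond_exp M G (indicator (Y -` B \<inter> space M)) \<omega> = measure (\<kappa> \<omega>) B"
    and g: "g \<in> borel_measurable (N \<Otimes>\<^sub>M L)"
  shows "\<exists>q\<in>borel_measurable M. (AE \<omega> in M. q \<omega> = (\<integral>\<^sup>+s. g (X \<omega>, s) \<partial>\<kappa> \<omega>)) \<and>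
    (\<integral>\<^sup>+\<omega>. g (X \<omega>, Y \<omega>) \<partial>M) = (\<integral>\<^sup>+\<omega>. q \<omega> \<partial>M)"
proof -
  interpret prob_space M by fact
  interpret finite_measure_subalgebra M G
    by unfold_locales (rule sub)
  have XM [measurable]: "X \<in> measurable M N"
    using sub X measurable_from_subalg by blast
  note Y [measurable]
  have meas_section: "(\<lambda>s. u (X \<omega>, s)) \<in> borel_measurable (\<kappa> \<omega>)"
    if "u \<in> borel_measurable (N \<Otimes>\<^sub>M L)" "\<omega> \<in> space M" for u :: "_ \<Rightarrow> ennreal" and \<omega>
  proof -
    have "X \<omega> \<in> space N" using measurable_space[OF XM that(2)] .
    then have "(\<lambda>s. u (X \<omega>, s)) \<in> borel_measurable L"
      using that(1) by measurable
    then show ?thesis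
      using measurable_cong_sets[OF \<kappa>(2) refl] by blast
  qed
  \<comment> \<open>\<open>Q u q\<close> says that \<open>q\<close> is a measurable stand-in for the
    inner integral of \<open>u\<close> with the right total. Such a \<open>q\<close> is found first
    for rectangles, then for measurable sets, then for nonnegative functions.\<close>
  define Q where "Q u q \<longleftrightarrow> q \<in> borel_measurable M \<and>
      (AE \<omega> in M. q \<omega> = (\<integral>\<^sup>+s. u (X \<omega>, s) \<partial>\<kappa> \<omega>)) \<and>
      (\<integral>\<^sup>+\<omega>. u (X \<omega>, Y \<omega>) \<partial>M) = (\<integral>\<^sup>+\<omega>. q \<omega> \<partial>M)" for u q
  have rect: "\<exists>q. Q (indicator (A \<times> B)) q" if A: "A \<in> sets N" and B: "B \<in> sets L" for A B
  proof -
    let ?c = "real_cond_exp M G (indicator (Y -` B \<inter> space M))"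
    \<comment> \<open>Built from the conditional expectation rather than from \<kappa>, since the
      former is known to be measurable.\<close>
    define q where "q \<omega> = ennreal (indicator A (X \<omega>) * ?c \<omega>)" for \<omega>
    have B' [measurable]: "Y -` B \<inter> space M \<in> sets M"
      using B Y by (rule measurable_sets[rotated])
    note A [measurable] B [measurable]
    have c [measurable]: "?c \<in> borel_measurable M"
      by simp
    have q [measurable]: "q \<in> borel_measurable M"
      unfolding q_def by measurable
    have kB: "emeasure (\<kappa> \<omega>) B = ennreal (measure (\<kappa> \<omega>) B)" for \<omega>
    proof -
      interpret k: prob_space "\<kappa> \<omega>" by (rule \<kappa>)
      show ?thesis by (rule k.emeasure_eq_measure)
    qed
    have 1: "AE \<omega> in M. q \<omega> = (\<integral>\<^sup>+s. indicator (A \<times> B) (X \<omega>, s) \<partial>\<kappa> \<omega>)"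
      using law[OF B]
    proof eventually_elim
      case (elim \<omega>)
      have "(\<integral>\<^sup>+s. indicator (A \<times> B) (X \<omega>, s) \<partial>\<kappa> \<omega>)
          = (\<integral>\<^sup>+s. indicator A (X \<omega>) * indicator B s \<partial>\<kappa> \<omega>)"
        by (simp add: indicator_times)
      also have "\<dots> = indicator A (X \<omega>) * emeasure (\<kappa> \<omega>) B"
        using B \<kappa>(2) by (subst nn_integral_cmult_indicator) auto
      finally show ?case
        using elim by (simp add: q_def kB indicator_def)
    qed
    have fM: "(\<lambda>\<omega>. indicator A (X \<omega>) :: real) \<in> borel_measurable G"
      using X by measurable
    have int: "integrable M (\<lambda>\<omega>. indicator A (X \<omega>) * indicator (Y -` B \<inter> space M) \<omega> :: real)"
      by (rule integrable_const_bound[where B=1]) (auto simp: indicator_def)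
    have cpos: "AE \<omega> in M. 0 \<le> ?c \<omega>"
      using law[OF B] by eventually_elim simp
    have "(\<integral>\<^sup>+\<omega>. indicator (A \<times> B) (X \<omega>, Y \<omega>) \<partial>M)
        = (\<integral>\<^sup>+\<omega>. ennreal (indicator A (X \<omega>) * indicator (Y -` B \<inter> space M) \<omega>) \<partial>M)"
      by (intro nn_integral_cong) (auto simp: indicator_def)
    also have "\<dots> = ennreal (\<integral>\<omega>. indicator A (X \<omega>) * indicator (Y -` B \<inter> space M) \<omega> \<partial>M)"
      by (rule nn_integral_eq_integral[OF int]) auto
    \<comment> \<open>The indicator of \<open>A\<close> at \<open>X\<close> is measurable for
      \<open>G\<close>, so it may serve as a test function for the conditional expectation.\<close>
    also have "\<dots> = ennreal (\<integral>\<omega>. indicator A (X \<omega>) * ?c \<omega> \<partial>M)"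
      by (subst real_cond_exp_intg(2)[OF int fM]) auto
    also have "\<dots> = (\<integral>\<^sup>+\<omega>. q \<omega> \<partial>M)"
      unfolding q_def
    proof (rule nn_integral_eq_integral[symmetric, OF real_cond_exp_intg(1)[OF int fM]])
      show "AE \<omega> in M. 0 \<le> indicator A (X \<omega>) * ?c \<omega>"
        using cpos by eventually_elim (rule mult_nonneg_nonneg, auto)
    qed auto
    finally show ?thesis
      unfolding Q_def using 1 q by blast
  qed
  have add_closed: "\<exists>q. Q (\<lambda>x. v x + u x) q"
    if "u \<in> borel_measurable (N \<Otimes>\<^sub>M L)" "v \<in> borel_measurable (N \<Otimes>\<^sub>M L)" "\<exists>q. Q u q" "\<exists>q. Q v q"
    for u v
  proof -
    note that(1,2) [measurable]
    obtain qu qv where qu: "Q u qu" and qv: "Q v qv"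
      using \<open>\<exists>q. Q u q\<close> \<open>\<exists>q. Q v q\<close> by blast
    then have [measurable]: "qu \<in> borel_measurable M" "qv \<in> borel_measurable M"
      by (auto simp: Q_def)
    have "AE \<omega> in M. qv \<omega> + qu \<omega> = (\<integral>\<^sup>+s. v (X \<omega>, s) + u (X \<omega>, s) \<partial>\<kappa> \<omega>)"
      using qu[unfolded Q_def, THEN conjunct2, THEN conjunct1]
        qv[unfolded Q_def, THEN conjunct2, THEN conjunct1] AE_space
      by eventually_elim (simp add: nn_integral_add meas_section that)
    then have "Q (\<lambda>x. v x + u x) (\<lambda>\<omega>. qv \<omega> + qu \<omega>)"
      using qu qv by (simp add: Q_def nn_integral_add)
    then show ?thesis by blast
  qed
  have cmult_closed: "\<exists>q. Q (\<lambda>x. c * u x) q"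
    if "u \<in> borel_measurable (N \<Otimes>\<^sub>M L)" "\<exists>q. Q u q" for u and c :: ennreal
  proof -
    note that(1) [measurable]
    obtain qu where qu: "Q u qu"
      using \<open>\<exists>q. Q u q\<close> by blast
    then have [measurable]: "qu \<in> borel_measurable M"
      by (auto simp: Q_def)
    have "AE \<omega> in M. c * qu \<omega> = (\<integral>\<^sup>+s. c * u (X \<omega>, s) \<partial>\<kappa> \<omega>)"
      using qu[unfolded Q_def, THEN conjunct2, THEN conjunct1] AE_space
      by eventually_elim (simp add: nn_integral_cmult meas_section that)
    then have "Q (\<lambda>x. c * u x) (\<lambda>\<omega>. c * qu \<omega>)"
      using qu by (simp add: Q_def nn_integral_cmult)
    then show ?thesis by blast
  qed
  have SUP_closed: "\<exists>q. Q (\<lambda>x. SUP i. U i x) q"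
    if U: "\<And>i. U i \<in> borel_measurable (N \<Otimes>\<^sub>M L)" and Uq: "\<And>i. \<exists>q. Q (U i) q"
      and inc: "incseq U" for U :: "nat \<Rightarrow> _"
  proof -
    note U [measurable]
    obtain q where q: "\<And>i. Q (U i) (q i)"
      using Uq by metis
    then have qm [measurable]: "q i \<in> borel_measurable M" for i
      by (auto simp: Q_def)
    \<comment> \<open>Countably many exceptional null sets merge into one.\<close>
    have qa: "AE \<omega> in M. \<forall>i. q i \<omega> = (\<integral>\<^sup>+s. U i (X \<omega>, s) \<partial>\<kappa> \<omega>)"
      using q by (simp add: Q_def AE_all_countable)
    have mono: "AE \<omega> in M. q i \<omega> \<le> q (Suc i) \<omega>" for i
      using qa
      by eventually_elim (use inc in \<open>auto simp: incseq_Suc_iff le_fun_def intro!: nn_integral_mono\<close>)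
    have ae: "AE \<omega> in M. (SUP i. q i \<omega>) = (\<integral>\<^sup>+s. (SUP i. U i (X \<omega>, s)) \<partial>\<kappa> \<omega>)"
      using qa AE_space
    proof eventually_elim
      case (elim \<omega>)
      have "(\<integral>\<^sup>+s. (SUP i. U i (X \<omega>, s)) \<partial>\<kappa> \<omega>) = (SUP i. \<integral>\<^sup>+s. U i (X \<omega>, s) \<partial>\<kappa> \<omega>)"
        using inc elim by (intro nn_integral_monotone_convergence_SUP meas_section U)
          (auto simp: incseq_def le_fun_def)
      then show ?case using elim by simp
    qed
    have "(\<integral>\<^sup>+\<omega>. (SUP i. U i (X \<omega>, Y \<omega>)) \<partial>M) = (SUP i. \<integral>\<^sup>+\<omega>. U i (X \<omega>, Y \<omega>) \<partial>M)"
      using inc by (intro nn_integral_monotone_convergence_SUP)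
        (auto simp: incseq_def le_fun_def)
    also have "\<dots> = (SUP i. \<integral>\<^sup>+\<omega>. q i \<omega> \<partial>M)"
      using q by (simp add: Q_def)
    \<comment> \<open>The \<open>q i\<close> increase only almost everywhere, which calls for the
      almost-everywhere form of monotone convergence.\<close>
    also have "\<dots> = (\<integral>\<^sup>+\<omega>. (SUP i. q i \<omega>) \<partial>M)"
      by (rule nn_integral_monotone_convergence_SUP_AE[symmetric]) (use mono in auto)
    finally have "Q (\<lambda>x. SUP i. U i x) (\<lambda>\<omega>. SUP i. q i \<omega>)"
      using ae by (simp add: Q_def)
    then show ?thesis by blast
  qed
  \<comment> \<open>Dynkin's argument: rectangles are stable under intersection and generate the
    product sigma-algebra.\<close>
  have measurable_set: "\<exists>q. Q (indicator E) q" if "E \<in> sets (N \<Otimes>\<^sub>M L)" for E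
    using that[unfolded sets_pair_measure]
  proof (induction rule: sigma_sets_induct_disjoint[OF Int_stable_pair_measure_generator
        pair_measure_closed, consumes 1, case_names basic empty compl union])
    case (basic E)
    then obtain A B where "E = A \<times> B" "A \<in> sets N" "B \<in> sets L" by auto
    then show ?case using rect by simp
  next
    case empty
    have "Q (indicator {}) (\<lambda>_. 0)" by (simp add: Q_def)
    then show ?case by blast
  next
    case (compl E)
    then obtain q where q: "Q (indicator E) q" by blast
    have E [measurable]: "E \<in> sets (N \<Otimes>\<^sub>M L)"
      using compl by (simp add: sets_pair_measure)
    have qm [measurable]: "q \<in> borel_measurable M" using q by (simp add: Q_def)
    let ?C = "space N \<times> space L - E"
    have ind: "indicator ?C (x, s) = (1 :: ennreal) - indicator E (x, s)"
      if "x \<in> space N" "s \<in> space L" for x s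
      using that by (auto simp: indicator_def)
    have sp: "X \<omega> \<in> space N" "Y \<omega> \<in> space L" "space (\<kappa> \<omega>) = space L" if "\<omega> \<in> space M" for \<omega>
      using that measurable_space[OF XM] measurable_space[OF Y] sets_eq_imp_space_eq[OF \<kappa>(2)] by auto
    \<comment> \<open>Subtraction in \<open>ennreal\<close> needs finite subtrahends; total mass one
      supplies this for the outer integral and, next, for the inner one.\<close>
    have fin: "(\<integral>\<^sup>+\<omega>. q \<omega> \<partial>M) \<noteq> \<infinity>"
    proof -
      have "(\<integral>\<^sup>+\<omega>. q \<omega> \<partial>M) = (\<integral>\<^sup>+\<omega>. indicator E (X \<omega>, Y \<omega>) \<partial>M)"
        using q by (simp add: Q_def)
      also have "\<dots> \<le> (\<integral>\<^sup>+\<omega>. 1 \<partial>M)"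
        by (intro nn_integral_mono) (auto simp: indicator_def)
      finally show ?thesis by (auto simp: emeasure_space_1 top_unique)
    qed
    have fin': "(\<integral>\<^sup>+s. indicator E (X \<omega>, s) \<partial>\<kappa> \<omega>) \<le> 1" for \<omega>
    proof -
      interpret k: prob_space "\<kappa> \<omega>" by (rule \<kappa>)
      have "(\<integral>\<^sup>+s. indicator E (X \<omega>, s) \<partial>\<kappa> \<omega>) \<le> (\<integral>\<^sup>+s. 1 \<partial>\<kappa> \<omega>)"
        by (intro nn_integral_mono) (auto simp: indicator_def)
      then show ?thesis by (simp add: k.emeasure_space_1)
    qed
    have ae: "AE \<omega> in M. 1 - q \<omega> = (\<integral>\<^sup>+s. indicator ?C (X \<omega>, s) \<partial>\<kappa> \<omega>)"
      using q[unfolded Q_def, THEN conjunct2, THEN conjunct1] AE_space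
    proof eventually_elim
      case (elim \<omega>)
      interpret k: prob_space "\<kappa> \<omega>" by (rule \<kappa>)
      have "(\<integral>\<^sup>+s. indicator ?C (X \<omega>, s) \<partial>\<kappa> \<omega>) = (\<integral>\<^sup>+s. 1 - indicator E (X \<omega>, s) \<partial>\<kappa> \<omega>)"
        using sp elim(2) by (intro nn_integral_cong ind) auto
      also have "\<dots> = (\<integral>\<^sup>+s. 1 \<partial>\<kappa> \<omega>) - (\<integral>\<^sup>+s. indicator E (X \<omega>, s) \<partial>\<kappa> \<omega>)"
        using elim(2) fin'[of \<omega>] by (intro nn_integral_diff meas_section)
          (auto simp: indicator_def top_unique split: if_splits)
      finally show ?case
        using elim(1) by (simp add: k.emeasure_space_1)
    qed
    have le1: "AE \<omega> in M. q \<omega> \<le> 1"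
      using q[unfolded Q_def, THEN conjunct2, THEN conjunct1]
      by eventually_elim (use fin' in simp)
    have "(\<integral>\<^sup>+\<omega>. indicator ?C (X \<omega>, Y \<omega>) \<partial>M) = (\<integral>\<^sup>+\<omega>. 1 - indicator E (X \<omega>, Y \<omega>) \<partial>M)"
      using sp by (intro nn_integral_cong ind) auto
    also have "\<dots> = (\<integral>\<^sup>+\<omega>. 1 \<partial>M) - (\<integral>\<^sup>+\<omega>. indicator E (X \<omega>, Y \<omega>) \<partial>M)"
      using fin q by (intro nn_integral_diff) (auto simp: Q_def indicator_def)
    also have "\<dots> = (\<integral>\<^sup>+\<omega>. 1 \<partial>M) - (\<integral>\<^sup>+\<omega>. q \<omega> \<partial>M)"
      using q by (simp add: Q_def)
    also have "\<dots> = (\<integral>\<^sup>+\<omega>. 1 - q \<omega> \<partial>M)"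
      using fin le1 by (intro nn_integral_diff[symmetric]) auto
    finally have "Q (indicator ?C) (\<lambda>\<omega>. 1 - q \<omega>)"
      using ae by (simp add: Q_def)
    then show ?case by blast
  next
    case (union E)
    have Em: "E i \<in> sets (N \<Otimes>\<^sub>M L)" for i
      using union by (auto simp: sets_pair_measure)
    \<comment> \<open>By disjointness these partial sums increase to the indicator of the union,
      which reduces the case to sums and suprema.\<close>
    define U where "U n x = (\<Sum>i<n. indicator (E i) x :: ennreal)" for n x
    have Um: "U n \<in> borel_measurable (N \<Otimes>\<^sub>M L)" for n
      unfolding U_def using Em by measurable
    have Uq: "\<exists>q. Q (U n) q" for n
    proof (induction n)
      case 0
      have "Q (U 0) (\<lambda>_. 0)" by (simp add: Q_def U_def)
      then show ?case by blast
    next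
      case (Suc n)
      have "\<exists>q. Q (\<lambda>x. U n x + indicator (E n) x) q"
        using Suc union Um Em by (intro add_closed) auto
      then show ?case by (simp add: U_def[abs_def])
    qed
    have "incseq U"
      by (auto simp: U_def[abs_def] incseq_def le_fun_def intro!: sum_mono2)
    moreover have "(SUP n. U n x) = indicator (\<Union>i. E i) x" for x
      using suminf_indicator[OF union(1), of x] by (simp add: suminf_eq_SUP U_def)
    ultimately have "\<exists>q. Q (indicator (\<Union>i. E i)) q"
      using SUP_closed[of U, OF Um Uq] by simp
    then show ?case using union by blast
  qed
  have "\<exists>q. Q g q"
    using g
  proof (induction rule: borel_measurable_induct)
    \<comment> \<open>The two functions agree only on the product space, but both integrals stay
      inside it.\<close>
    case (cong g f)
    then obtain q where q: "Q f q" using cong by blast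
    have fg: "f (x, s) = g (x, s)" if "x \<in> space N" "s \<in> space L" for x s
      using cong that by (auto simp: space_pair_measure)
    have sp: "X \<omega> \<in> space N" "Y \<omega> \<in> space L" "space (\<kappa> \<omega>) = space L" if "\<omega> \<in> space M" for \<omega>
      using that measurable_space[OF XM] measurable_space[OF Y] sets_eq_imp_space_eq[OF \<kappa>(2)] by auto
    have 1: "AE \<omega> in M. q \<omega> = (\<integral>\<^sup>+s. g (X \<omega>, s) \<partial>\<kappa> \<omega>)"
      using q[unfolded Q_def, THEN conjunct2, THEN conjunct1] AE_space
    proof eventually_elim
      case (elim \<omega>)
      have "(\<integral>\<^sup>+s. f (X \<omega>, s) \<partial>\<kappa> \<omega>) = (\<integral>\<^sup>+s. g (X \<omega>, s) \<partial>\<kappa> \<omega>)"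
        using sp elim(2) by (intro nn_integral_cong fg) auto
      then show ?case using elim by simp
    qed
    have "(\<integral>\<^sup>+\<omega>. f (X \<omega>, Y \<omega>) \<partial>M) = (\<integral>\<^sup>+\<omega>. g (X \<omega>, Y \<omega>) \<partial>M)"
      using sp by (intro nn_integral_cong fg) auto
    then have "Q g q" using q 1 by (simp add: Q_def)
    then show ?case by blast
  next
    case (set A)
    then show ?case by (rule measurable_set)
  next
    case (mult u c)
    then show ?case by (intro cmult_closed) auto
  next
    case (add u v)
    then show ?case by (intro add_closed) auto
  next
    case (seq U)
    then show ?case using SUP_closed[of U] by (simp add: SUP_apply[abs_def])
  qed
  then show ?thesis unfolding Q_def by blast
qed

section \<open>Sketched Newton--Raphson steps\<close>

lemma inner_matrix_vector_mult_left: "((A :: real^'n^'m) *v x) \<bullet> y = x \<bullet> (transpose A *v y)"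
  by (metis dot_lmul_matrix inner_commute transpose_matrix_vector)

lemma transpose_H: "transpose (H F x S) = H F x S"
proof -
  let ?N = "transpose S ** transpose (DF F x) ** DF F x ** S"
  have "transpose ?N = ?N"
    by (simp add: matrix_transpose_mul matrix_mul_assoc)
  then have "transpose (pinv ?N) = pinv ?N"
    by (metis pinv_transpose)
  then show ?thesis
    by (simp add: H_def matrix_transpose_mul matrix_mul_assoc)
qed

text \<open>With \<open>N\<close> the Gram matrix of \<open>DF F x ** S\<close>, the product
  contains \<open>pinv N ** N ** pinv N\<close>, which collapses by the second Penrose
  equation.\<close>

lemma H_mult_gram_mult_H: "H F x S ** (transpose (DF F x) ** DF F x) ** H F x S = H F x S"
proof -
  let ?N = "transpose S ** transpose (DF F x) ** DF F x ** S"
  have "H F x S ** (transpose (DF F x) ** DF F x) ** H F x S =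
      S ** (pinv ?N ** ?N ** pinv ?N) ** transpose S"
    by (simp add: H_def matrix_mul_assoc)
  also have "\<dots> = H F x S"
    using penrose_pinv[of ?N] by (simp only: penrose_def H_def)
  finally show ?thesis .
qed

lemma norm_DF_H_squared: "(norm (DF F x *v (H F x S *v v)))\<^sup>2 = v \<bullet> (H F x S *v v)"
proof -
  have "(norm (DF F x *v (H F x S *v v)))\<^sup>2 =
      v \<bullet> ((transpose (H F x S) ** (transpose (DF F x) ** DF F x) ** H F x S) *v v)"
    by (simp add: power2_norm_eq_inner inner_matrix_vector_mult_left matrix_vector_mul_assoc
        matrix_mul_assoc matrix_transpose_mul del: transpose_matrix_vector)
  then show ?thesis
    by (simp only: transpose_H H_mult_gram_mult_H)
qed

section \<open>Expected sketched matrix and gradient of the subproblem\<close>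

lemma bounded_linear_transpose: "bounded_linear (transpose :: real^'n^'m \<Rightarrow> real^'m^'n)"
  by (rule linear_conv_bounded_linear[THEN iffD1], rule linearI)
    (simp_all add: transpose_def vec_eq_iff)

lemma bounded_linear_matrix_vector_mult_left: "bounded_linear (\<lambda>A :: real^'n^'m. A *v v)"
  by (rule linear_conv_bounded_linear[THEN iffD1], rule linearI)
    (simp_all add: matrix_vector_mult_add_rdistrib scaleR_matrix_vector_assoc)

text \<open>Transposition is bounded linear, so it passes through the integral, and it fixes the
  integrand.\<close>

lemma transpose_expected_H:
  assumes "integrable (D y) (H F y)"
  shows "transpose (expected_H F D y) = expected_H F D y"
  using integral_bounded_linear[OF bounded_linear_transpose assms]
  unfolding transpose_H expected_H_def by (rule sym)

lemma grad_eqI: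
  assumes "GDERIV f x :> g"
  shows "grad f x = g"
  unfolding grad_def
proof (rule the_equality)
  fix g' assume "GDERIV f x :> g'"
  then have "(\<lambda>h. h \<bullet> g') = (\<lambda>h. h \<bullet> g)"
    using assms has_derivative_unique unfolding gderiv_def by blast
  \<comment> \<open>The equal derivatives are tested in the direction of the difference of the two
    candidates.\<close>
  then have "(g' - g) \<bullet> g' = (g' - g) \<bullet> g"
    by (rule fun_cong)
  then have "(g' - g) \<bullet> (g' - g) = 0"
    by (simp add: inner_diff_right)
  then show "g' = g"
    by simp
qed (rule assms)

text \<open>The expected matrix belongs to \<open>y\<close> and is constant during differentiation.
  The product rule yields two terms, equal by its symmetry, which absorb the factor one
  half.\<close>

lemma grad_f_sub:
  assumes "F differentiable (at x)" and "integrable (D y) (H F y)"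
  shows "grad (f_sub F D y) x = DF F x *v (expected_H F D y *v F x)"
proof (rule grad_eqI)
  let ?B = "expected_H F D y"
  have F: "(F has_derivative (\<lambda>h. jacobian F (at x) *v h)) (at x)"
    using assms(1) by (simp add: jacobian_works)
  have "((\<lambda>x. 1/2 * (F x \<bullet> (?B *v F x))) has_derivative
      (\<lambda>h. 1/2 * (F x \<bullet> (?B *v (jacobian F (at x) *v h)) + (jacobian F (at x) *v h) \<bullet> (?B *v F x)))) (at x)"
    by (rule has_derivative_mult_right[OF has_derivative_inner[OF F
          bounded_linear.has_derivative[OF matrix_vector_mul_bounded_linear F]]])
  also have "(\<lambda>h. 1/2 * (F x \<bullet> (?B *v (jacobian F (at x) *v h)) + (jacobian F (at x) *v h) \<bullet> (?B *v F x)))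
      = (\<lambda>h. h \<bullet> (DF F x *v (?B *v F x)))"
  proof
    fix h
    have "F x \<bullet> (?B *v (jacobian F (at x) *v h)) = (?B *v (jacobian F (at x) *v h)) \<bullet> F x"
      by (rule inner_commute)
    also have "\<dots> = (jacobian F (at x) *v h) \<bullet> (?B *v F x)"
      using inner_matrix_vector_mult_left[of ?B "jacobian F (at x) *v h" "F x"]
        transpose_expected_H[where D=D and y=y, OF assms(2)] by metis
    finally show "1/2 * (F x \<bullet> (?B *v (jacobian F (at x) *v h)) + (jacobian F (at x) *v h) \<bullet> (?B *v F x))
        = h \<bullet> (DF F x *v (?B *v F x))"
      using inner_matrix_vector_mult_left[of "jacobian F (at x)" h "?B *v F x"]
      by (simp only: DF_def) simp
  qed
  finally show "GDERIV (f_sub F D y) x :> DF F x *v (?B *v F x)"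
    unfolding gderiv_def f_sub_def[abs_def] .
qed

text \<open>Point and sketch are separate arguments: conditioning on the past freezes the first, and
  only the second is averaged.\<close>

definition snr_step ::
  "(real^'p \<Rightarrow> real^'m) \<Rightarrow> real \<Rightarrow> real^'p \<Rightarrow> real^'t^'m \<Rightarrow> real^'p" where
  "snr_step F \<gamma> x S = x - \<gamma> *\<^sub>R (DF F x *v (H F x S *v F x))"

lemma snr_iter_Suc: "snr_iter F \<gamma> x0 S (Suc k) = snr_step F \<gamma> (snr_iter F \<gamma> x0 S k) (S k)"
  by (simp add: snr_step_def H_def Let_def matrix_vector_mul_assoc matrix_mul_assoc)

text \<open>The point \<open>x\<close> is fixed and only the sketch is random; convexity enters for
  the function attached to \<open>x\<close> itself.\<close>

lemma snr_step_contraction: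
  fixes D :: "real^'p \<Rightarrow> (real^'t^'m) measure" and F :: "real^'p \<Rightarrow> real^'m"
  assumes D: "prob_space (D x)" and int: "integrable (D x) (H F x)"
    and F: "F differentiable (at x)" and root: "F xstar = 0"
    and conv: "f_sub F D x xstar \<ge>
           f_sub F D x x + grad (f_sub F D x) x \<bullet> (xstar - x) + \<mu> / 2 * (norm (xstar - x))\<^sup>2"
    and \<gamma>: "0 < \<gamma>" "\<gamma> \<le> 1"
  shows "integrable (D x) (\<lambda>S. (norm (snr_step F \<gamma> x S - xstar))\<^sup>2)"
    and "(\<integral>S. (norm (snr_step F \<gamma> x S - xstar))\<^sup>2 \<partial>D x) \<le> (1 - \<gamma> * \<mu>) * (norm (x - xstar))\<^sup>2"
proof -
  interpret prob_space "D x" by fact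
  let ?v = "F x" and ?G = "DF F x" and ?B = "expected_H F D x"
  \<comment> \<open>The squared length of the direction is linear in \<open>H F x S\<close>, so the
    whole expression is affine in it and its integrability and mean follow from those of
    \<open>H F x\<close>.\<close>
  have expand: "(norm (snr_step F \<gamma> x S - xstar))\<^sup>2 = (norm (x - xstar))\<^sup>2
      + 2 * \<gamma> * ((xstar - x) \<bullet> (?G *v (H F x S *v ?v))) + \<gamma>\<^sup>2 * (?v \<bullet> (H F x S *v ?v))" for S
  proof -
    let ?u = "?G *v (H F x S *v ?v)"
    have "snr_step F \<gamma> x S - xstar = (x - xstar) - \<gamma> *\<^sub>R ?u"
      by (simp add: snr_step_def)
    then have "(norm (snr_step F \<gamma> x S - xstar))\<^sup>2 =
        (norm (x - xstar))\<^sup>2 - 2 * ((x - xstar) \<bullet> (\<gamma> *\<^sub>R ?u)) + (norm (\<gamma> *\<^sub>R ?u))\<^sup>2"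
      using dot_norm_neg[of "x - xstar" "\<gamma> *\<^sub>R ?u"] by (simp only:) (simp add: field_simps)
    also have "\<dots> = (norm (x - xstar))\<^sup>2 + 2 * \<gamma> * ((xstar - x) \<bullet> ?u) + \<gamma>\<^sup>2 * (norm ?u)\<^sup>2"
      by (simp add: power_mult_distrib inner_diff_left right_diff_distrib)
    finally show ?thesis
      by (simp only: norm_DF_H_squared)
  qed
  have bl1: "bounded_linear (\<lambda>A. (xstar - x) \<bullet> (?G *v (A *v ?v)))"
    by (intro bounded_linear_inner_right_comp bounded_linear_compose[OF matrix_vector_mul_bounded_linear]
        bounded_linear_matrix_vector_mult_left)
  have bl2: "bounded_linear (\<lambda>A. ?v \<bullet> (A *v ?v))"
    by (intro bounded_linear_inner_right_comp bounded_linear_matrix_vector_mult_left)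
  note int1 = integrable_bounded_linear[OF bl1 int] integrable_bounded_linear[OF bl2 int]
  note eq1 = integral_bounded_linear[OF bl1 int] integral_bounded_linear[OF bl2 int]
  show "integrable (D x) (\<lambda>S. (norm (snr_step F \<gamma> x S - xstar))\<^sup>2)"
    unfolding expand using int1 by simp
  have eq: "(\<integral>S. (norm (snr_step F \<gamma> x S - xstar))\<^sup>2 \<partial>D x) = (norm (x - xstar))\<^sup>2
      + 2 * \<gamma> * ((xstar - x) \<bullet> (?G *v (?B *v ?v))) + \<gamma>\<^sup>2 * (?v \<bullet> (?B *v ?v))"
    unfolding expand using int1 eq1 by (simp add: prob_space expected_H_def)
  \<comment> \<open>The integrand is a squared length. This sign later permits replacing
    \<open>\<gamma>\<^sup>2\<close> by \<gamma>.\<close>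
  have "0 \<le> (\<integral>S. ?v \<bullet> (H F x S *v ?v) \<partial>D x)"
    by (rule integral_nonneg_AE) (simp flip: norm_DF_H_squared)
  then have pos: "0 \<le> ?v \<bullet> (?B *v ?v)"
    using eq1(2) by (simp add: expected_H_def)
  \<comment> \<open>The value of \<open>f_sub F D x\<close> at \<open>xstar\<close> vanishes because
    \<open>F xstar = 0\<close>.\<close>
  have "0 \<ge> 1/2 * (?v \<bullet> (?B *v ?v)) + (xstar - x) \<bullet> (?G *v (?B *v ?v)) + \<mu> / 2 * (norm (x - xstar))\<^sup>2"
    using conv grad_f_sub[where D=D and y=x, OF F int] root
    by (simp add: f_sub_def inner_commute norm_minus_commute)
  then have "2 * \<gamma> * (1/2 * (?v \<bullet> (?B *v ?v)) + (xstar - x) \<bullet> (?G *v (?B *v ?v)) + \<mu> / 2 * (norm (x - xstar))\<^sup>2) \<le> 0"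
    using \<gamma> by (intro mult_nonneg_nonpos) auto
  moreover have "\<gamma>\<^sup>2 * (?v \<bullet> (?B *v ?v)) \<le> \<gamma> * (?v \<bullet> (?B *v ?v))"
    using \<gamma> pos by (intro mult_right_mono) (auto simp: power2_eq_square mult_left_le)
  ultimately show "(\<integral>S. (norm (snr_step F \<gamma> x S - xstar))\<^sup>2 \<partial>D x) \<le> (1 - \<gamma> * \<mu>) * (norm (x - xstar))\<^sup>2"
    unfolding eq by (simp add: algebra_simps)
qed

text \<open>\<open>F\<close> and \<open>DF F\<close> are continuous and the pseudoinverse is Borel,
  so the step is jointly measurable in point and sketch.\<close>

lemma borel_measurable_snr_step:
  assumes F: "continuously_differentiable F"
    and [measurable]: "X \<in> borel_measurable M" "S \<in> borel_measurable M"
  shows "(\<lambda>\<omega>. snr_step F \<gamma> (X \<omega>) (S \<omega> :: real^'t^'m)) \<in> borel_measurable M"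
proof -
  have [measurable]: "(\<lambda>\<omega>. DF F (X \<omega>)) \<in> borel_measurable M"
    using F unfolding DF_def continuously_differentiable_def
    by (intro borel_measurable_continuous_on[where f="\<lambda>x. transpose (jacobian F (at x))"]
        continuous_on_transpose) auto
  have [measurable]: "(\<lambda>\<omega>. F (X \<omega>)) \<in> borel_measurable M"
    using F unfolding continuously_differentiable_def
    by (intro borel_measurable_continuous_on[where f=F])
      (auto intro: differentiable_imp_continuous_on simp: differentiable_on_def differentiable_at_withinI)
  show ?thesis
    unfolding snr_step_def H_def by measurable
qed

section \<open>The history of the run\<close>

lemma subalgebra_sketch_history:
  fixes S :: "nat \<Rightarrow> 'w \<Rightarrow> real^'t^'m"
  assumes [measurable]: "\<And>k. S k \<in> borel_measurable M"
  shows "subalgebra M (sketch_history M S k)"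
  unfolding subalgebra_def sketch_history_def
  by (intro conjI sets_image_in_sets) (simp_all add: measurable_restrict)

text \<open>Iterate \<open>j\<close> uses only the sketches before index \<open>j\<close>. Fixing
  \<open>k\<close> keeps the sigma-algebra constant during the induction; the case
  \<open>j = k\<close> makes the current iterate known when \<open>S k\<close> is drawn.\<close>

lemma snr_iter_measurable_history:
  fixes S :: "nat \<Rightarrow> 'w \<Rightarrow> real^'t^'m"
  assumes F: "continuously_differentiable F" and "j \<le> k"
  shows "(\<lambda>\<omega>. snr_iter F \<gamma> x0 (\<lambda>i. S i \<omega>) j) \<in> borel_measurable (sketch_history M S k)"
  using \<open>j \<le> k\<close>
proof (induction j)
  case (Suc j)
  have "(\<lambda>\<omega>. (\<lambda>i\<in>{..<k}. S i \<omega>)) \<in> measurable (sketch_history M S k) (Pi\<^sub>M {..<k} (\<lambda>_. borel))"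
    unfolding sketch_history_def by (rule measurable_vimage_algebra1) (auto simp: space_PiM)
  from measurable_compose[OF this measurable_component_singleton[of j]]
  have "S j \<in> borel_measurable (sketch_history M S k)"
    using Suc.prems by simp
  then show ?case
    unfolding snr_iter_Suc using Suc by (intro borel_measurable_snr_step[OF F]) auto
qed simp

section \<open>Linear convergence in mean square\<close>

theorem theorem4p11:
  fixes F :: "real^'p \<Rightarrow> real^'m"
    and D :: "real^'p \<Rightarrow> (real^'t^'m) measure"
    and xstar x0 :: "real^'p"
    and \<mu> \<gamma> :: real
  assumes "continuously_differentiable F"
    and "\<And>x. prob_space (D x)" and "\<And>x. sets (D x) = sets borel"
    and "\<And>x. integrable (D x) (H F x)"
    and "F xstar = 0"
    and "\<mu> > 0"
    and "\<And>x y. f_sub F D y xstar \<ge>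
           f_sub F D y x + grad (f_sub F D y) x \<bullet> (xstar - x) + \<mu> / 2 * (norm (xstar - x))\<^sup>2"
    and "0 < \<gamma>" and "\<gamma> \<le> 1"
  shows "\<mu> \<le> 1 \<and>
    (\<forall>(M :: 'w measure) S. snr_sketches F D \<gamma> x0 M S \<longrightarrow>
      (\<forall>k. integrable M (\<lambda>\<omega>. (norm (snr_iter F \<gamma> x0 (\<lambda>i. S i \<omega>) (k + 1) - xstar))\<^sup>2) \<and>
           (\<integral>\<omega>. (norm (snr_iter F \<gamma> x0 (\<lambda>i. S i \<omega>) (k + 1) - xstar))\<^sup>2 \<partial>M)
             \<le> (1 - \<gamma> * \<mu>) ^ (k + 1) * (norm (x0 - xstar))\<^sup>2))"
proof -
  have F: "F differentiable (at x)" for x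
    using assms(1) by (simp add: continuously_differentiable_def)
  note step = snr_step_contraction[OF assms(2,4) F assms(5,7)]
  have mu: "\<mu> \<le> 1"
  proof -
    \<comment> \<open>Any point at distance one from \<open>xstar\<close> serves. The one-step bound
      is applied with stepsize 1, whatever the given \<gamma>.\<close>
    define x where "x = xstar + axis undefined 1"
    have "0 \<le> (\<integral>S. (norm (snr_step F 1 x S - xstar))\<^sup>2 \<partial>D x)"
      by simp
    also have "\<dots> \<le> (1 - 1 * \<mu>) * (norm (x - xstar))\<^sup>2"
      by (rule step) auto
    finally show ?thesis
      by (simp add: x_def)
  qed
  \<comment> \<open>A nonnegative factor lets the bounds be multiplied along the recursion and
    carried into \<open>ennreal\<close>.\<close>
  then have rate: "0 \<le> 1 - \<gamma> * \<mu>"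
    using assms(6,8,9) mult_le_one[of \<gamma> \<mu>] by simp
  \<comment> \<open>Stated at index \<open>k\<close> so that induction starts from the deterministic
    \<open>x0\<close>; the claim is its instance at \<open>k + 1\<close>.\<close>
  have "integrable M (\<lambda>\<omega>. (norm (snr_iter F \<gamma> x0 (\<lambda>i. S i \<omega>) k - xstar))\<^sup>2) \<and>
           (\<integral>\<omega>. (norm (snr_iter F \<gamma> x0 (\<lambda>i. S i \<omega>) k - xstar))\<^sup>2 \<partial>M)
             \<le> (1 - \<gamma> * \<mu>) ^ k * (norm (x0 - xstar))\<^sup>2"
    if sketches: "snr_sketches F D \<gamma> x0 M S" for M :: "'w measure" and S k
  proof -
    let ?X = "\<lambda>k \<omega>. snr_iter F \<gamma> x0 (\<lambda>i. S i \<omega>) k"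
    have M: "prob_space M" and S [measurable]: "\<And>k. S k \<in> borel_measurable M"
      and law: "\<And>k A. A \<in> sets borel \<Longrightarrow> AE \<omega> in M.
        real_cond_exp M (sketch_history M S k) (indicator (S k -` A \<inter> space M)) \<omega> =
        measure (D (?X k \<omega>)) A"
      using sketches by (auto simp: snr_sketches_def)
    interpret prob_space M by fact
    note hist = subalgebra_sketch_history[where S=S, OF S]
    note X = snr_iter_measurable_history[OF assms(1) order_refl, of \<gamma> x0 S]
    note XM [measurable] = measurable_from_subalg[OF hist X]
    \<comment> \<open>Nonnegative integrals carry the induction; integrability is then read off from
      the finite bound.\<close>
    have "(\<integral>\<^sup>+\<omega>. ennreal ((norm (?X k \<omega> - xstar))\<^sup>2) \<partial>M)
        \<le> ennreal ((1 - \<gamma> * \<mu>) ^ k * (norm (x0 - xstar))\<^sup>2)"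
    proof (induction k)
      case 0
      then show ?case by (simp add: emeasure_space_1)
    next
      case (Suc k)
      define g where "g = (\<lambda>(x, s :: real^'t^'m). ennreal ((norm (snr_step F \<gamma> x s - xstar))\<^sup>2))"
      have g: "g \<in> borel_measurable (borel \<Otimes>\<^sub>M borel)"
      proof -
        have [measurable]: "(\<lambda>p. snr_step F \<gamma> (fst p) (snd p)) \<in> borel_measurable (borel \<Otimes>\<^sub>M borel)"
          by (rule borel_measurable_snr_step[OF assms(1)]) auto
        show ?thesis
          unfolding g_def split_beta' by measurable
      qed
      have "\<exists>q\<in>borel_measurable M. (AE \<omega> in M. q \<omega> = (\<integral>\<^sup>+s. g (?X k \<omega>, s) \<partial>D (?X k \<omega>))) \<and>
          (\<integral>\<^sup>+\<omega>. g (?X k \<omega>, S k \<omega>) \<partial>M) = (\<integral>\<^sup>+\<omega>. q \<omega> \<partial>M)"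
        by (rule disintegration_cond_law[where \<kappa>="\<lambda>\<omega>. D (?X k \<omega>)" and X="?X k" and Y="S k",
              OF M hist X S assms(2,3) law g])
      then obtain q where "AE \<omega> in M. q \<omega> = (\<integral>\<^sup>+s. g (?X k \<omega>, s) \<partial>D (?X k \<omega>))"
        and q: "(\<integral>\<^sup>+\<omega>. g (?X k \<omega>, S k \<omega>) \<partial>M) = (\<integral>\<^sup>+\<omega>. q \<omega> \<partial>M)"
        by blast
      \<comment> \<open>Proved for every deterministic \<open>x\<close>, then evaluated at the
        random current iterate.\<close>
      moreover have "(\<integral>\<^sup>+s. g (x, s) \<partial>D x) \<le> ennreal (1 - \<gamma> * \<mu>) * ennreal ((norm (x - xstar))\<^sup>2)" for x
      proof -
        have "(\<integral>\<^sup>+s. g (x, s) \<partial>D x) = ennreal (\<integral>s. (norm (snr_step F \<gamma> x s - xstar))\<^sup>2 \<partial>D x)"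
          unfolding g_def using step(1)[OF assms(8,9)] by (simp add: nn_integral_eq_integral)
        also have "\<dots> \<le> ennreal ((1 - \<gamma> * \<mu>) * (norm (x - xstar))\<^sup>2)"
          by (intro ennreal_leI step(2) assms(8,9))
        finally show ?thesis
          using rate by (simp add: ennreal_mult)
      qed
      ultimately have "AE \<omega> in M. q \<omega> \<le> ennreal (1 - \<gamma> * \<mu>) * ennreal ((norm (?X k \<omega> - xstar))\<^sup>2)"
        by (auto elim: eventually_mono)
      then have "(\<integral>\<^sup>+\<omega>. q \<omega> \<partial>M) \<le> (\<integral>\<^sup>+\<omega>. ennreal (1 - \<gamma> * \<mu>) * ennreal ((norm (?X k \<omega> - xstar))\<^sup>2) \<partial>M)"
        by (rule nn_integral_mono_AE)
      also have "\<dots> = ennreal (1 - \<gamma> * \<mu>) * (\<integral>\<^sup>+\<omega>. ennreal ((norm (?X k \<omega> - xstar))\<^sup>2) \<partial>M)"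
        by (rule nn_integral_cmult) measurable
      also have "\<dots> \<le> ennreal (1 - \<gamma> * \<mu>) * ennreal ((1 - \<gamma> * \<mu>) ^ k * (norm (x0 - xstar))\<^sup>2)"
        by (intro mult_left_mono Suc) simp
      also have "\<dots> = ennreal ((1 - \<gamma> * \<mu>) ^ Suc k * (norm (x0 - xstar))\<^sup>2)"
        using rate by (simp add: ennreal_mult mult.assoc)
      finally show ?case
        using q unfolding snr_iter_Suc g_def by simp
    qed
    note bound = this
    have int: "integrable M (\<lambda>\<omega>. (norm (?X k \<omega> - xstar))\<^sup>2)"
      using bound by (intro integrableI_bounded) (auto intro: le_less_trans)
    have "ennreal (\<integral>\<omega>. (norm (?X k \<omega> - xstar))\<^sup>2 \<partial>M) \<le> ennreal ((1 - \<gamma> * \<mu>) ^ k * (norm (x0 - xstar))\<^sup>2)"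
      using bound nn_integral_eq_integral[OF int] by simp
    then show ?thesis
      using int rate by (simp add: ennreal_le_iff)
  qed
  with mu show ?thesis by blast
qed

end
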